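(* Let $\gamma\in(0,1)$, $d\ge1$ an integer and $T>0$. For any quasi-geometric bracket extension $\mathbb X$ (a $\gamma$-quasi-geometric rough path associated to $\hat T(\mathbb A^d_\gamma)$), the function $\psi_{\mathcal S}^*\mathbb X$, given by $\langle\psi_{\mathcal S}^*\mathbb X_{st},f\rangle=\langle\mathbb X_{st},\psi_{\mathcal S}(f)\rangle$ for $s,t\in[0,T]$ and forests $f\in\mathcal F(\mathcal A^d_\gamma)$ with $|f|_\gamma\le N_\gamma$, is a simple bracket extension.
   Context: $N_\gamma=\lfloor\gamma^{-1}\rfloor$. Words. $\mathbb A^d_\gamma=\{\alpha\in\mathbb N^d\setminus\{0\}:|\alpha|\le N_\gamma\}$, $|\alpha|=\sum_i\alpha_i$, with canonical basis vectors $e_1,\dots,e_d$. $W(\mathbb A^d_\gamma)$ is the set of words in these letters (including the empty word $\mathbf 1$), $T(\mathbb A^d_\gamma)$ the free real vector space on it. The commutative bracket on $\mathbb R^{\mathbb A^d_\gamma}$ is the bilinear map with $[\alpha,\beta]_\gamma=\alpha+\beta$ if $\alpha+\beta\in\mathbb A^d_\gamma$ and $0$ otherwise. The quasi-shuffle product $\widehat{\sqcup\!\sqcup}_\gamma$ has unit $\mathbf 1$ and satisfies $va\,\widehat{\sqcup\!\sqcup}_\gamma\,wb=(v\,\widehat{\sqcup\!\sqcup}_\gamma\,wb)a+(va\,\widehat{\sqcup\!\sqcup}_\gamma\,w)b+(v\,\widehat{\sqcup\!\sqcup}_\gamma\,w)[a,b]_\gamma$; $\hat T(\mathbb A^d_\gamma)$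 is $T(\mathbb A^d_\gamma)$ with this product and the deconcatenation coproduct $\nabla(a_1\cdots a_m)=\sum_{i=0}^m a_1\cdots a_i\otimes a_{i+1}\cdots a_m$. The weight is $\Vert\alpha_1\cdots\alpha_l\Vert_\gamma=\sum_j|\alpha_j|$, $\Vert\mathbf 1\Vert_\gamma=0$. A quasi-geometric bracket extension is a function $\mathbb X\colon[0,T]^2\to(T^{N_\gamma})^*$, $T^{N_\gamma}$ the span of words with $\Vert w\Vert_\gamma\le N_\gamma$, such that: $\langle\mathbb X_{st},x\,\widehat{\sqcup\!\sqcup}_\gamma\,y\rangle=\langle\mathbb X_{st},x\rangle\langle\mathbb X_{st},y\rangle$ whenever $x,y,x\,\widehat{\sqcup\!\sqcup}_\gamma\,y\in T^{N_\gamma}$; $\mathbb X_{su}*\mathbb X_{ut}=\mathbb X_{st}$ for all $s,u,t\in[0,T]$, where $\langle\alpha*\beta,h\rangle=\langle\alpha\otimes\beta,\nabla h\rangle$; and $\sup_{s\ne t}|\langle\mathbb X_{st},w\rangle||t-s|^{-\gamma\Vert w\Vert_\gamma}<\infty$ for every word $w\in T^{N_\gamma}$. Forests. For a finite set $A$, $\mathcal F(A)$ is the set of finite (commutative) forests of rooted non-planar trees with nodes labelled by $A$, including the empty forest $\mathbf 1$; $B^+_a(\tau_1\cdots\tau_m)$ is the tree obtained by grafting the roots of $\tau_1,\dots,\tau_m$ onto a new root labelled $a$, and $\bullet_a=B_a^+(\mathbf 1)$. $\mathcal H(A)$ is the free real vector space on $\mathcal F(A)$, with product the disjoint union and multiplicative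 coproduct $\Delta$ given by $\Delta\mathbf 1=\mathbf 1\otimes\mathbf 1$, $\Delta B^+_a(\sigma)=B^+_a(\sigma)\otimes\mathbf 1+(\mathrm{id}\otimes B_a^+)\Delta\sigma$ (Butcher-Connes-Kreimer Hopf algebra). $\mathcal A^d_\gamma=\bigcup_{n=1}^{N_\gamma}\{1,\dots,d\}^n$, with elements written $(i_1\cdots i_n)$, and $(i)=i$. The weight $|\cdot|_\gamma$ on $\mathcal F(\mathcal A^d_\gamma)$ is the sum over all nodes of the lengths $n$ of their labels $(i_1\cdots i_n)$. Two labels are symmetrical, $a\sim b$, if they have the same length and one is a permutation of the other; two forests satisfy $\sigma\sim\tau$ if one is obtained from the other by replacing labels of nodes with symmetrical labels. The bracket polynomial is $$\langle\!\langle i_1\cdots i_n\rangle\!\rangle=\bullet_{i_1}\cdots\bullet_{i_n}-\sum B^+_{(b_1\cdots b_k)}(\bullet_{a_1}\cdots\bullet_{a_{n-k}}),$$ the sum being over all ways of splitting the $n$ indices $i_1,\dots,i_n$ (by position) into two non-empty families $a=\{a_1,\dots,a_{n-k}\}$, $b=\{b_1,\dots,b_k\}$, listed in the induced order. A simple bracket extension is a function $\widehat{\mathbf X}\colon[0,T]^2\to(\mathcal H^{N_\gamma})^*$, $\mathcal H^{N_\gamma}$ the span of the forests $f\in\mathcal F(\mathcal A^d_\gamma)$ with $|f|_\gamma\le N_\gamma$, that is a $\gamma$-weighted rough path over $\mathcal H(\mathcal A_\gamma^d)$, i.e. $\langle\widehat{\mathbf X}_{st},xy\rangle=\langle\widehat{\mathbf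 X}_{st},x\rangle\langle\widehat{\mathbf X}_{st},y\rangle$ whenever $x,y,xy\in\mathcal H^{N_\gamma}$, $\widehat{\mathbf X}_{su}*\widehat{\mathbf X}_{ut}=\widehat{\mathbf X}_{st}$ for all $s,u,t$ (convolution dual to $\Delta$), $\sup_{s\ne t}|\langle\widehat{\mathbf X}_{st},f\rangle||t-s|^{-\gamma|f|_\gamma}<\infty$ for every forest $f\in\mathcal H^{N_\gamma}$, and such that moreover: (1) $\langle\widehat{\mathbf X}_{st},\bullet_{(i_1\cdots i_n)}\rangle=\langle\widehat{\mathbf X}_{st},\langle\!\langle i_1\cdots i_n\rangle\!\rangle\rangle$ for all $i_1,\dots,i_n\in\{1,\dots,d\}$, $1\le n\le N_\gamma$, and $s,t\in[0,T]$; (2) $\langle\widehat{\mathbf X}_{st},\tau\rangle=\langle\widehat{\mathbf X}_{st},\sigma\rangle$ for all forests $\sigma\sim\tau$ in $\mathcal H^{N_\gamma}$. The map $\psi_{\mathcal S}$. Let $S\colon\mathcal A^d_\gamma\to\mathbb A^d_\gamma$, $S((i_1\cdots i_n))=(m_1,\dots,m_d)$ with $m_j=\sharp\{l:i_l=j\}$, i.e. $S((i_1\cdots i_n))=e_{i_1}+\cdots+e_{i_n}$. The symmetrization map $\mathcal S\colon\mathcal H(\mathcal A^d_\gamma)\to\mathcal H(\mathbb A^d_\gamma)$ is the linear map applying $S$ to every label. The contracting arborification $\psi\colon\mathcal H(\mathbb A^d_\gamma)\to\hat T(\mathbb A^d_\gamma)$ is the linear map with $\psi(\mathbf 1)=\mathbf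 1$, $\psi(B^+_a(f))=\psi(f)a$, $\psi(\sigma\tau)=\psi(\sigma)\,\widehat{\sqcup\!\sqcup}_\gamma\,\psi(\tau)$. Finally $\psi_{\mathcal S}=\psi\circ\mathcal S$. *)

theory Defs
  imports
    "HOL-Analysis.Analysis"
    "HOL-Library.Multiset"
    "HOL-Library.Poly_Mapping"
begin

section \<open>Free real vector spaces\<close>

text \<open>
  The free real vector space on a type 'b is 'b \<open>\<Rightarrow>\<^sub>0\<close> real, the free space on a subset
  B of 'b is \<open>free_space B\<close>, and the tensor square of the former is ('b \<open>\<times>\<close> 'b) \<open>\<Rightarrow>\<^sub>0\<close> real.
\<close>

instantiation poly_mapping :: (type, real_vector) real_vector
begin

lift_definition scaleR_poly_mapping :: "real \<Rightarrow> ('a \<Rightarrow>\<^sub>0 'b) \<Rightarrow> 'a \<Rightarrow>\<^sub>0 'b"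
  is "\<lambda>c f a. c *\<^sub>R f a"
  by (rule finite_subset) auto

instance
  by standard (transfer; simp add: fun_eq_iff scaleR_add_right scaleR_add_left)+

end

lemma lookup_scaleR [simp]: "Poly_Mapping.lookup (c *\<^sub>R x) a = c *\<^sub>R Poly_Mapping.lookup x a"
  by transfer simp

abbreviation basis :: "'b \<Rightarrow> 'b \<Rightarrow>\<^sub>0 real" where
  "basis b \<equiv> Poly_Mapping.single b 1"

definition free_space :: "'b set \<Rightarrow> ('b \<Rightarrow>\<^sub>0 real) set" where
  "free_space B = span (basis ` B)"

text \<open>The linear extension to the free vector space of a map given on the basis.\<close>

definition lin_ext :: "('b \<Rightarrow> 'v::real_vector) \<Rightarrow> ('b \<Rightarrow>\<^sub>0 real) \<Rightarrow> 'v" where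
  "lin_ext f x = (\<Sum>b\<in>Poly_Mapping.keys x. Poly_Mapping.lookup x b *\<^sub>R f b)"

definition bilin_ext :: "('a \<Rightarrow> 'b \<Rightarrow> 'v::real_vector) \<Rightarrow> ('a \<Rightarrow>\<^sub>0 real) \<Rightarrow> ('b \<Rightarrow>\<^sub>0 real) \<Rightarrow> 'v" where
  "bilin_ext f x y = lin_ext (\<lambda>a. lin_ext (f a) y) x"

lemma lin_ext_superset:
  assumes "finite S" "Poly_Mapping.keys x \<subseteq> S"
  shows "lin_ext f x = (\<Sum>b\<in>S. Poly_Mapping.lookup x b *\<^sub>R f b)"
  unfolding lin_ext_def using assms
  by (intro sum.mono_neutral_left) (auto simp: in_keys_iff)

lemma lin_ext_basis [simp]: "lin_ext f (basis b) = f b"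
  by (simp add: lin_ext_def)

lemma linear_lin_ext: "linear (lin_ext f)"
proof (rule linearI)
  fix x y :: "'a \<Rightarrow>\<^sub>0 real"
  let ?S = "Poly_Mapping.keys x \<union> Poly_Mapping.keys y"
  have "lin_ext f (x + y) = (\<Sum>b\<in>?S. Poly_Mapping.lookup (x + y) b *\<^sub>R f b)"
    by (rule lin_ext_superset) (simp_all add: Poly_Mapping.keys_add)
  also have "\<dots> = (\<Sum>b\<in>?S. Poly_Mapping.lookup x b *\<^sub>R f b) + (\<Sum>b\<in>?S. Poly_Mapping.lookup y b *\<^sub>R f b)"
    by (simp add: lookup_add scaleR_add_left sum.distrib)
  also have "\<dots> = lin_ext f x + lin_ext f y"
    by (subst (1 2) lin_ext_superset[of ?S]) auto
  finally show "lin_ext f (x + y) = lin_ext f x + lin_ext f y" .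
next
  fix c and x :: "'a \<Rightarrow>\<^sub>0 real"
  have "lin_ext f (c *\<^sub>R x) = (\<Sum>b\<in>Poly_Mapping.keys x. Poly_Mapping.lookup (c *\<^sub>R x) b *\<^sub>R f b)"
    by (rule lin_ext_superset) (auto simp: in_keys_iff)
  then show "lin_ext f (c *\<^sub>R x) = c *\<^sub>R lin_ext f x"
    by (simp add: lin_ext_def scaleR_sum_right)
qed

lemma poly_mapping_decompose:
  "x = (\<Sum>b\<in>Poly_Mapping.keys x. Poly_Mapping.lookup x b *\<^sub>R basis b)" for x :: "'b \<Rightarrow>\<^sub>0 real"
proof (rule poly_mapping_eqI)
  fix k
  have "(\<Sum>b\<in>Poly_Mapping.keys x. Poly_Mapping.lookup x b * Poly_Mapping.lookup (basis b) k) =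
        (\<Sum>b\<in>Poly_Mapping.keys x. if b = k then Poly_Mapping.lookup x b else 0)"
    by (intro sum.cong) (auto simp: lookup_single)
  then show "Poly_Mapping.lookup x k = Poly_Mapping.lookup (\<Sum>b\<in>Poly_Mapping.keys x. Poly_Mapping.lookup x b *\<^sub>R basis b) k"
    by (simp add: lookup_sum in_keys_iff)
qed

lemma linear_eq_lin_ext:
  assumes "linear f"
  shows "f x = lin_ext (\<lambda>b. f (basis b)) x"
  by (subst poly_mapping_decompose)
     (simp add: lin_ext_def linear_sum[OF assms] linear_scale[OF assms])

lemma linear_eq_on_basis:
  assumes "linear f" "linear g" "\<And>b. f (basis b) = g (basis b)"
  shows "f x = g x"
  using linear_eq_lin_ext[OF assms(1), of x] linear_eq_lin_ext[OF assms(2), of x] assms(3)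
  by simp

section \<open>Weighted rough paths\<close>

definition linear_functional_on :: "'v::real_vector set \<Rightarrow> ('v \<Rightarrow> real) \<Rightarrow> bool" where
  "linear_functional_on V \<phi> \<longleftrightarrow>
     (\<forall>x\<in>V. \<forall>y\<in>V. \<phi> (x + y) = \<phi> x + \<phi> y) \<and> (\<forall>c. \<forall>x\<in>V. \<phi> (c *\<^sub>R x) = c * \<phi> x)"

text \<open>The functional \<open>\<phi> * \<theta>\<close> dual to a coproduct, i.e.
  \<open>h \<mapsto> \<langle>\<phi> \<otimes> \<theta>, coprod h\<rangle>\<close>.\<close>

definition convolution ::
  "(('b \<Rightarrow>\<^sub>0 real) \<Rightarrow> ('b \<times> 'b \<Rightarrow>\<^sub>0 real)) \<Rightarrow>
   (('b \<Rightarrow>\<^sub>0 real) \<Rightarrow> real) \<Rightarrow> (('b \<Rightarrow>\<^sub>0 real) \<Rightarrow> real) \<Rightarrow> ('b \<Rightarrow>\<^sub>0 real) \<Rightarrow> real" where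
  "convolution coprod \<phi> \<theta> h =
     lin_ext (\<lambda>(u, v). \<phi> (basis u) * \<theta> (basis v)) (coprod h)"

definition trunc :: "real \<Rightarrow> nat" where
  "trunc \<gamma> = nat \<lfloor>inverse \<gamma>\<rfloor>"

definition trunc_basis :: "real \<Rightarrow> 'b set \<Rightarrow> ('b \<Rightarrow> nat) \<Rightarrow> 'b set" where
  "trunc_basis \<gamma> B wt = {b \<in> B. wt b \<le> trunc \<gamma>}"

text \<open>
  A \<open>\<gamma>\<close>-weighted rough path on [0, T] over the graded Hopf algebra with basis B, weight
  wt, product mul and coproduct coprod.  Only the values of \<open>X s t\<close> for s, t in [0, T] on
  the truncated space are relevant.
\<close>

definition weighted_rough_path ::
  "real \<Rightarrow> real \<Rightarrow> 'b set \<Rightarrow> ('b \<Rightarrow> nat) \<Rightarrow>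
   (('b \<Rightarrow>\<^sub>0 real) \<Rightarrow> ('b \<Rightarrow>\<^sub>0 real) \<Rightarrow> ('b \<Rightarrow>\<^sub>0 real)) \<Rightarrow>
   (('b \<Rightarrow>\<^sub>0 real) \<Rightarrow> ('b \<times> 'b \<Rightarrow>\<^sub>0 real)) \<Rightarrow>
   (real \<Rightarrow> real \<Rightarrow> ('b \<Rightarrow>\<^sub>0 real) \<Rightarrow> real) \<Rightarrow> bool" where
  "weighted_rough_path \<gamma> T B wt mul coprod X \<longleftrightarrow>
     (let BN = trunc_basis \<gamma> B wt; VN = free_space BN in
      (\<forall>s\<in>{0..T}. \<forall>t\<in>{0..T}. linear_functional_on VN (X s t)) \<and>
      (\<forall>s\<in>{0..T}. \<forall>t\<in>{0..T}. \<forall>x\<in>VN. \<forall>y\<in>VN. mul x y \<in> VN \<longrightarrow>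
         X s t (mul x y) = X s t x * X s t y) \<and>
      (\<forall>s\<in>{0..T}. \<forall>u\<in>{0..T}. \<forall>t\<in>{0..T}. \<forall>h\<in>VN.
         convolution coprod (X s u) (X u t) h = X s t h) \<and>
      (\<forall>b\<in>BN. bdd_above {\<bar>X s t (basis b)\<bar> * \<bar>t - s\<bar> powr (- \<gamma> * real (wt b)) | s t.
         s \<in> {0..T} \<and> t \<in> {0..T} \<and> s \<noteq> t}))"

section \<open>The quasi-shuffle Hopf algebra\<close>

text \<open>
  The dimension is d = CARD('d): multi-indices are elements of nat ^ 'd, and the index set
  \<open>{1, \<dots>, d}\<close> is the type 'd.
\<close>

definition msize :: "nat ^ 'd \<Rightarrow> nat" where
  "msize \<alpha> = (\<Sum>i\<in>UNIV. \<alpha> $ i)"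

definition letters :: "nat \<Rightarrow> (nat ^ 'd) set" where
  "letters N = {\<alpha>. \<alpha> \<noteq> 0 \<and> msize \<alpha> \<le> N}"

definition word_weight :: "(nat ^ 'd) list \<Rightarrow> nat" where
  "word_weight w = sum_list (map msize w)"

text \<open>The bracket on basis elements.  Setting it to 0 outside its domain
  makes it associative on the whole type, hence also the quasi-shuffle product.\<close>

definition bracket :: "nat \<Rightarrow> nat ^ 'd \<Rightarrow> nat ^ 'd \<Rightarrow> (nat ^ 'd \<Rightarrow>\<^sub>0 real)" where
  "bracket N \<alpha> \<beta> =
     (if \<alpha> \<in> letters N \<and> \<beta> \<in> letters N \<and> \<alpha> + \<beta> \<in> letters N then basis (\<alpha> + \<beta>) else 0)"

text \<open>Appending on the right a linear combination of letters.\<close>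

definition append_letters :: "('a list \<Rightarrow>\<^sub>0 real) \<Rightarrow> ('a \<Rightarrow>\<^sub>0 real) \<Rightarrow> ('a list \<Rightarrow>\<^sub>0 real)" where
  "append_letters = bilin_ext (\<lambda>w a. basis (w @ [a]))"

fun qsh_word ::
  "nat \<Rightarrow> (nat ^ 'd) list \<Rightarrow> (nat ^ 'd) list \<Rightarrow> ((nat ^ 'd) list \<Rightarrow>\<^sub>0 real)" where
  "qsh_word N x y =
     (if x = [] then basis y
      else if y = [] then basis x
      else append_letters (qsh_word N (butlast x) y) (basis (last x))
         + append_letters (qsh_word N x (butlast y)) (basis (last y))
         + append_letters (qsh_word N (butlast x) (butlast y)) (bracket N (last x) (last y)))"

declare qsh_word.simps [simp del]

lemma qsh_word_simps:
  "qsh_word N [] w = basis w"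
  "qsh_word N w [] = basis w"
  "qsh_word N (v @ [a]) (w @ [b]) =
     append_letters (qsh_word N v (w @ [b])) (basis a)
     + append_letters (qsh_word N (v @ [a]) w) (basis b)
     + append_letters (qsh_word N v w) (bracket N a b)"
  by (simp_all add: qsh_word.simps)

definition qsh ::
  "nat \<Rightarrow> ((nat ^ 'd) list \<Rightarrow>\<^sub>0 real) \<Rightarrow> ((nat ^ 'd) list \<Rightarrow>\<^sub>0 real) \<Rightarrow> ((nat ^ 'd) list \<Rightarrow>\<^sub>0 real)" where
  "qsh N = bilin_ext (qsh_word N)"

definition deconcat :: "('a list \<Rightarrow>\<^sub>0 real) \<Rightarrow> ('a list \<times> 'a list \<Rightarrow>\<^sub>0 real)" where
  "deconcat = lin_ext (\<lambda>w. \<Sum>i\<le>length w. basis (take i w, drop i w))"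

definition quasi_geometric_bracket_extension ::
  "real \<Rightarrow> real \<Rightarrow> (real \<Rightarrow> real \<Rightarrow> ((nat ^ 'd) list \<Rightarrow>\<^sub>0 real) \<Rightarrow> real) \<Rightarrow> bool" where
  "quasi_geometric_bracket_extension \<gamma> T X \<longleftrightarrow>
     weighted_rough_path \<gamma> T (lists (letters (trunc \<gamma>))) word_weight
       (qsh (trunc \<gamma>)) deconcat X"

section \<open>The Butcher-Connes-Kreimer Hopf algebra\<close>

datatype 'a rtree = Node 'a "'a rtree multiset"

type_synonym 'a forest = "'a rtree multiset"

text \<open>
  The product of \<open>\<H>(A)\<close> is the multiplication of 'a forest \<open>\<Rightarrow>\<^sub>0\<close> real, the convolution for
  the addition (disjoint union) of forests; likewise the multiplication of
  ('a forest \<open>\<times>\<close> 'a forest) \<open>\<Rightarrow>\<^sub>0\<close> real is that of \<open>\<H>(A) \<otimes> \<H>(A)\<close>.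
\<close>

lemma basis_mult: "basis f * basis g = basis (f + g)" for f g :: "'b::monoid_add"
  by (simp add: mult_single)

definition forests :: "'a set \<Rightarrow> 'a forest set" where
  "forests A = {f. \<forall>t\<in>#f. set_rtree t \<subseteq> A}"

abbreviation bullet :: "'a \<Rightarrow> 'a rtree" where
  "bullet a \<equiv> Node a {#}"

primrec coproduct_tree :: "'a rtree \<Rightarrow> ('a forest \<times> 'a forest \<Rightarrow>\<^sub>0 real)" where
  "coproduct_tree (Node a f) =
     basis ({#Node a f#}, {#}) +
     lin_ext (\<lambda>(g, h). basis (g, {#Node a h#})) (prod_mset (image_mset coproduct_tree f))"

definition coproduct :: "('a forest \<Rightarrow>\<^sub>0 real) \<Rightarrow> ('a forest \<times> 'a forest \<Rightarrow>\<^sub>0 real)" where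
  "coproduct = lin_ext (\<lambda>f. prod_mset (image_mset coproduct_tree f))"

lemma coproduct_graft:
  "coproduct (basis {#Node a f#}) =
     basis ({#Node a f#}, {#}) + lin_ext (\<lambda>(g, h). basis (g, {#Node a h#})) (coproduct (basis f))"
  by (simp add: coproduct_def)

lemma coproduct_union:
  "coproduct (basis (f + g)) = coproduct (basis f) * coproduct (basis g)"
  by (simp add: coproduct_def)

primrec tree_weight :: "'a list rtree \<Rightarrow> nat" where
  "tree_weight (Node a f) = length a + sum_mset (image_mset tree_weight f)"

definition forest_weight :: "'a list forest \<Rightarrow> nat" where
  "forest_weight f = sum_mset (image_mset tree_weight f)"

section \<open>Simple bracket extensions\<close>

definition tuples :: "nat \<Rightarrow> 'd list set" where
  "tuples N = {l. 1 \<le> length l \<and> length l \<le> N}"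

text \<open>The relation \<open>\<sim>\<close>: the relators of the tree and multiset types relate forests of
  the same shape whose corresponding labels are permutations of each other.\<close>

definition symmetric_forests :: "'d list forest \<Rightarrow> 'd list forest \<Rightarrow> bool" where
  "symmetric_forests = rel_mset (rel_rtree (\<lambda>a b. mset a = mset b))"

text \<open>The splitting is given by the set K of the positions of the indices forming b.\<close>

definition bracket_polynomial :: "'d list \<Rightarrow> ('d list forest \<Rightarrow>\<^sub>0 real)" where
  "bracket_polynomial l =
     (let bullets = (\<lambda>a. image_mset (\<lambda>i. bullet [i]) (mset a)) in
      basis (bullets l) -
      (\<Sum>K | K \<subseteq> {..<length l} \<and> K \<noteq> {} \<and> K \<noteq> {..<length l}.
         basis {#Node (nths l K) (bullets (nths l ({..<length l} - K)))#}))"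

definition simple_bracket_extension ::
  "real \<Rightarrow> real \<Rightarrow> (real \<Rightarrow> real \<Rightarrow> ('d list forest \<Rightarrow>\<^sub>0 real) \<Rightarrow> real) \<Rightarrow> bool" where
  "simple_bracket_extension \<gamma> T X \<longleftrightarrow>
     weighted_rough_path \<gamma> T (forests (tuples (trunc \<gamma>))) forest_weight (*) coproduct X \<and>
     (\<forall>l\<in>tuples (trunc \<gamma>). \<forall>s\<in>{0..T}. \<forall>t\<in>{0..T}.
        X s t (basis {#bullet l#}) = X s t (bracket_polynomial l)) \<and>
     (\<forall>\<sigma>\<in>trunc_basis \<gamma> (forests (tuples (trunc \<gamma>))) forest_weight.
      \<forall>\<tau>\<in>trunc_basis \<gamma> (forests (tuples (trunc \<gamma>))) forest_weight.
        symmetric_forests \<sigma> \<tau> \<longrightarrow>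
        (\<forall>s\<in>{0..T}. \<forall>t\<in>{0..T}. X s t (basis \<tau>) = X s t (basis \<sigma>)))"

section \<open>Symmetrization and contracting arborification\<close>

definition symm_label :: "'d list \<Rightarrow> nat ^ 'd" where
  "symm_label l = (\<chi> j. count_list l j)"

definition symmetrization :: "('d list forest \<Rightarrow>\<^sub>0 real) \<Rightarrow> ((nat ^ 'd) forest \<Rightarrow>\<^sub>0 real)" where
  "symmetrization = lin_ext (\<lambda>f. basis (image_mset (map_rtree symm_label) f))"

text \<open>
  The product over the trees of a forest is a fold, which is independent of the order since
  the quasi-shuffle product is commutative and associative; the defining equations of
  \<open>\<psi>\<close> are derived at the end.
\<close>

definition qsh_prod :: "nat \<Rightarrow> ((nat ^ 'd) list \<Rightarrow>\<^sub>0 real) multiset \<Rightarrow> ((nat ^ 'd) list \<Rightarrow>\<^sub>0 real)" where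
  "qsh_prod N = fold_mset (qsh N) (basis [])"

primrec arbor_tree :: "nat \<Rightarrow> (nat ^ 'd) rtree \<Rightarrow> ((nat ^ 'd) list \<Rightarrow>\<^sub>0 real)" where
  "arbor_tree N (Node a f) =
     append_letters (qsh_prod N (image_mset (arbor_tree N) f)) (basis a)"

definition arborification :: "nat \<Rightarrow> ((nat ^ 'd) forest \<Rightarrow>\<^sub>0 real) \<Rightarrow> ((nat ^ 'd) list \<Rightarrow>\<^sub>0 real)" where
  "arborification N = lin_ext (\<lambda>f. qsh_prod N (image_mset (arbor_tree N) f))"

definition psi_S :: "nat \<Rightarrow> ('d list forest \<Rightarrow>\<^sub>0 real) \<Rightarrow> ((nat ^ 'd) list \<Rightarrow>\<^sub>0 real)" where
  "psi_S N = arborification N \<circ> symmetrization"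

subsection \<open>The defining equations\<close>

lemma linear_bilin_ext_left: "linear (\<lambda>x. bilin_ext f x y)"
  unfolding bilin_ext_def by (rule linear_lin_ext)

lemma linear_bilin_ext_right: "linear (bilin_ext f x)"
  unfolding bilin_ext_def lin_ext_def[of _ x]
  by (intro linear_compose_sum linear_compose_scale_right linear_lin_ext ballI)

lemma bilin_ext_basis [simp]: "bilin_ext f (basis a) (basis b) = f a b"
  by (simp add: bilin_ext_def)

lemma linear_append_letters_left: "linear (\<lambda>x. append_letters x l)"
  unfolding append_letters_def by (rule linear_bilin_ext_left)

lemma linear_append_letters_right: "linear (append_letters x)"
  unfolding append_letters_def by (rule linear_bilin_ext_right)

lemma linear_qsh_left: "linear (\<lambda>x. qsh N x y)"
  unfolding qsh_def by (rule linear_bilin_ext_left)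

lemma linear_qsh_right: "linear (qsh N x)"
  unfolding qsh_def by (rule linear_bilin_ext_right)

lemmas bilinear_simps =
  linear_add[OF linear_append_letters_left] linear_add[OF linear_append_letters_right]
  linear_0[OF linear_append_letters_left] linear_0[OF linear_append_letters_right]
  linear_add[OF linear_qsh_left] linear_add[OF linear_qsh_right]
  linear_0[OF linear_qsh_left] linear_0[OF linear_qsh_right]

lemma qsh_one [simp]: "qsh N (basis []) x = x" "qsh N x (basis []) = x"
  by (rule linear_eq_on_basis[OF linear_qsh_right linear_ident];
      simp add: qsh_def qsh_word_simps)
     (rule linear_eq_on_basis[OF linear_qsh_left linear_ident];
      simp add: qsh_def qsh_word_simps)

lemma qsh_append:
  "qsh N (append_letters x (basis a)) (append_letters y (basis b)) =
     append_letters (qsh N x (append_letters y (basis b))) (basis a)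
     + append_letters (qsh N (append_letters x (basis a)) y) (basis b)
     + append_letters (qsh N x y) (bracket N a b)" (is "?L x y = ?R x y")
proof -
  note lin = linear_compose[unfolded o_def]
  have L: "linear (\<lambda>x. ?L x y)" "linear (?L x)" for x y
    by (intro lin[OF linear_append_letters_left linear_qsh_left]
              lin[OF linear_append_letters_left linear_qsh_right])+
  have R: "linear (\<lambda>x. ?R x y)" "linear (?R x)" for x y
    by (intro linear_compose_add lin[OF _ linear_append_letters_left]
          lin[OF linear_append_letters_left linear_qsh_left]
          lin[OF linear_append_letters_left linear_qsh_right] linear_qsh_left linear_qsh_right)+
  have "?L (basis v) (basis w) = ?R (basis v) (basis w)" for v w
    by (simp add: append_letters_def qsh_def) (simp add: qsh_word_simps append_letters_def)
  then have "?L (basis v) y = ?R (basis v) y" for v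
    by (rule linear_eq_on_basis[OF L(2) R(2)])
  then show ?thesis
    by (rule linear_eq_on_basis[OF L(1) R(1)])
qed

lemma append_letters_basis [simp]: "append_letters (basis w) (basis a) = basis (w @ [a])"
  by (simp add: append_letters_def)

lemma bracket_commute: "bracket N a b = bracket N b a"
  by (simp add: bracket_def add.commute conj_ac)

lemma qsh_word_commute: "qsh_word N v w = qsh_word N w v"
proof (induction "length v + length w" arbitrary: v w rule: less_induct)
  case less
  show ?case
  proof (cases v rule: rev_cases; cases w rule: rev_cases)
    fix v' a w' b
    assume eq: "v = v' @ [a]" "w = w' @ [b]"
    show ?thesis
      using less[of v' w] less[of v w'] less[of v' w'] bracket_commute[of N a b]
      by (simp add: eq qsh_word_simps add_ac)
  qed (simp_all add: qsh_word_simps)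
qed

lemma qsh_commute: "qsh N x y = qsh N y x"
proof -
  have "qsh N (basis v) (basis w) = qsh N (basis w) (basis v)" for v w
    by (simp add: qsh_def qsh_word_commute)
  then have "qsh N (basis v) y = qsh N y (basis v)" for v
    by (rule linear_eq_on_basis[OF linear_qsh_right linear_qsh_left])
  then show ?thesis
    by (rule linear_eq_on_basis[OF linear_qsh_left linear_qsh_right])
qed

lemma msize_add: "msize (a + b) = msize a + msize b"
  by (simp add: msize_def sum.distrib)

lemma qsh_append_bracket:
  "qsh N (append_letters x (bracket N a b)) (append_letters y (basis c)) =
     append_letters (qsh N x (append_letters y (basis c))) (bracket N a b)
     + append_letters (qsh N (append_letters x (bracket N a b)) y) (basis c)
     + append_letters (qsh N x y) (lin_ext (\<lambda>e. bracket N e c) (bracket N a b))"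
  by (auto simp: bracket_def[of N a b] qsh_append bilinear_simps
        linear_0[OF linear_lin_ext])

lemma qsh_append_bracket':
  "qsh N (append_letters x (basis a)) (append_letters y (bracket N b c)) =
     append_letters (qsh N x (append_letters y (bracket N b c))) (basis a)
     + append_letters (qsh N (append_letters x (basis a)) y) (bracket N b c)
     + append_letters (qsh N x y) (lin_ext (bracket N a) (bracket N b c))"
  by (auto simp: bracket_def[of N b c] qsh_append bilinear_simps
        linear_0[OF linear_lin_ext])

lemma bracket_assoc:
  "lin_ext (\<lambda>e. bracket N e c) (bracket N a b) = lin_ext (bracket N a) (bracket N b c)"
proof -
  have nz: "x + y \<noteq> 0" if "x \<noteq> 0" for x y :: "nat ^ 'a"
    using that by (auto simp: vec_eq_iff)
  show ?thesis
    by (auto simp: bracket_def linear_0[OF linear_lin_ext] letters_def msize_add nz add.assoc)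
qed

lemma qsh_word_assoc:
  "qsh N (qsh N (basis u) (basis v)) (basis w) = qsh N (basis u) (qsh N (basis v) (basis w))"
proof (induction "length u + length v + length w" arbitrary: u v w rule: less_induct)
  case less
  show ?case
  proof (cases "u = [] \<or> v = [] \<or> w = []")
    case True
    then show ?thesis by auto
  next
    case False
    then obtain u' a v' b w' c where eq: "u = u' @ [a]" "v = v' @ [b]" "w = w' @ [c]"
      by (metis rev_exhaust)
    let ?p = "basis u'" and ?q = "basis v'" and ?r = "basis w'"
    let ?P = "append_letters ?p (basis a)" and ?Q = "append_letters ?q (basis b)"
      and ?R = "append_letters ?r (basis c)"
    have IH:
      "qsh N (qsh N ?p ?Q) ?R = qsh N ?p (qsh N ?Q ?R)"
      "qsh N (qsh N ?P ?q) ?R = qsh N ?P (qsh N ?q ?R)"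
      "qsh N (qsh N ?P ?Q) ?r = qsh N ?P (qsh N ?Q ?r)"
      "qsh N (qsh N ?p ?q) ?R = qsh N ?p (qsh N ?q ?R)"
      "qsh N (qsh N ?p ?Q) ?r = qsh N ?p (qsh N ?Q ?r)"
      "qsh N (qsh N ?P ?q) ?r = qsh N ?P (qsh N ?q ?r)"
      "qsh N (qsh N ?p ?q) ?r = qsh N ?p (qsh N ?q ?r)"
      using less[of u' v w] less[of u v' w] less[of u v w'] less[of u' v' w]
        less[of u' v w'] less[of u v' w'] less[of u' v' w'] by (simp_all add: eq)
    have "qsh N (qsh N ?P ?Q) ?R =
        append_letters (qsh N (qsh N ?p ?Q) ?R) (basis a)
      + append_letters (qsh N (qsh N ?P ?q) ?R) (basis b)
      + append_letters (qsh N (qsh N ?p ?q) ?R) (bracket N a b)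
      + append_letters (qsh N (qsh N ?P ?Q) ?r) (basis c)
      + append_letters (qsh N (qsh N ?p ?Q) ?r) (bracket N a c)
      + append_letters (qsh N (qsh N ?P ?q) ?r) (bracket N b c)
      + append_letters (qsh N (qsh N ?p ?q) ?r) (lin_ext (\<lambda>e. bracket N e c) (bracket N a b))"
      unfolding qsh_append[of N ?p a ?q b]
      by (simp only: bilinear_simps qsh_append qsh_append_bracket) (simp only: add_ac)
    moreover have "qsh N ?P (qsh N ?Q ?R) =
        append_letters (qsh N ?p (qsh N ?Q ?R)) (basis a)
      + append_letters (qsh N ?P (qsh N ?q ?R)) (basis b)
      + append_letters (qsh N ?P (qsh N ?Q ?r)) (basis c)
      + append_letters (qsh N ?P (qsh N ?q ?r)) (bracket N b c)
      + append_letters (qsh N ?p (qsh N ?q ?R)) (bracket N a b)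
      + append_letters (qsh N ?p (qsh N ?Q ?r)) (bracket N a c)
      + append_letters (qsh N ?p (qsh N ?q ?r)) (lin_ext (bracket N a) (bracket N b c))"
      unfolding qsh_append[of N ?q b ?r c]
      by (simp only: bilinear_simps qsh_append qsh_append_bracket') (simp only: add_ac)
    ultimately have "qsh N (qsh N ?P ?Q) ?R = qsh N ?P (qsh N ?Q ?R)"
      unfolding IH bracket_assoc by (simp only: add_ac)
    then show ?thesis by (simp add: eq)
  qed
qed

lemma qsh_assoc: "qsh N (qsh N x y) z = qsh N x (qsh N y z)"
proof -
  note lin = linear_compose[unfolded o_def]
  have "qsh N (qsh N (basis u) (basis v)) z = qsh N (basis u) (qsh N (basis v) z)" for u v
    by (rule linear_eq_on_basis[OF linear_qsh_right lin[OF linear_qsh_right linear_qsh_right]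
          qsh_word_assoc])
  then have "qsh N (qsh N (basis u) y) z = qsh N (basis u) (qsh N y z)" for u
    by (rule linear_eq_on_basis[OF lin[OF linear_qsh_right linear_qsh_left]
          lin[OF linear_qsh_left linear_qsh_right]])
  then show ?thesis
    by (rule linear_eq_on_basis[OF lin[OF linear_qsh_left linear_qsh_left] linear_qsh_left])
qed

interpretation qsh: comp_fun_commute "qsh N" for N
proof
  fix x y
  have "qsh N y (qsh N x z) = qsh N x (qsh N y z)" for z
    by (metis qsh_assoc qsh_commute)
  then show "qsh N y \<circ> qsh N x = qsh N x \<circ> qsh N y"
    by (simp add: fun_eq_iff)
qed

lemma qsh_prod_simps:
  "qsh_prod N {#} = basis []"
  "qsh_prod N (add_mset x M) = qsh N x (qsh_prod N M)"
  "qsh_prod N (M + M') = qsh N (qsh_prod N M) (qsh_prod N M')"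
proof -
  show *: "qsh_prod N {#} = basis []" "\<And>x M. qsh_prod N (add_mset x M) = qsh N x (qsh_prod N M)"
    by (simp_all add: qsh_prod_def)
  show "qsh_prod N (M + M') = qsh N (qsh_prod N M) (qsh_prod N M')"
    by (induction M) (simp_all add: * qsh_assoc)
qed

lemma arborification_one: "arborification N 1 = basis []"
  unfolding single_one[symmetric] arborification_def lin_ext_basis
  by (simp add: qsh_prod_simps)

lemma arborification_graft:
  "arborification N (basis {#Node a f#}) = append_letters (arborification N (basis f)) (basis a)"
  by (simp add: arborification_def qsh_prod_simps)

lemma arborification_union:
  "arborification N (basis (f + g)) = qsh N (arborification N (basis f)) (arborification N (basis g))"
  by (simp add: arborification_def qsh_prod_simps)

lemma symm_label_eq_sum: "symm_label l = (\<Sum>i\<leftarrow>l. axis i 1)"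
  by (induction l) (auto simp: symm_label_def vec_eq_iff axis_def)

end

theory Submission
  imports Defs
begin

text \<open>
  Pulling back along \<open>\<psi>\<^sub>\<S>\<close> turns every defining property of a quasi-geometric bracket extension
  into the corresponding property of a simple bracket extension, because \<open>\<psi>\<^sub>\<S>\<close> is a weight
  preserving morphism of bialgebras from forests to words.

  It is an algebra morphism by construction, and it is homogeneous because a contraction
  \<open>[a, b]\<close> either vanishes or has the joint weight of its two letters (\<open>keys_psi_S\<close>); this yields
  multiplicativity and the analytic bounds.  It is a coalgebra morphism (\<open>deconcat_psi_S\<close>), which
  yields Chen's relation: both coproducts are multiplicative (\<open>deconcat_qsh\<close> for words) and
  both satisfy the same cocycle equation, \<open>\<psi>\<^sub>\<S>\<close> intertwining the grafting onto a root with
  the appending of a last letter.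

  The two conditions special to simple bracket extensions hold already at the level of \<open>\<psi>\<^sub>\<S>\<close>.
  Symmetrical forests have the same image since \<open>S\<close> forgets the order of the indices.  For the
  bracket polynomial of a tuple of length n, let \<open>e\<^sub>k\<close> be the single letter word of its k-th
  index.  The words of the quasi-shuffle product \<open>e\<^sub>1 \<cdots> e\<^sub>n\<close> can be sorted by the non-empty
  set K of those indices that were contracted into the last letter, and those for a given K form
  the quasi-shuffle product of the \<open>e\<^sub>j\<close> with \<open>j \<notin> K\<close>, followed by the sum of the letters of K
  (\<open>qsh_prod_units\<close>).  The term for the full set K is the image of \<open>\<bullet>\<^bsub>(i\<^sub>1\<dots>i\<^sub>n)\<^esub>\<close>, and the others are
  the images of the trees subtracted in the bracket polynomial.
\<close>

section \<open>Linear and bilinear maps on free vector spaces\<close>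

lemma bilinear_eq_on_basis:
  assumes "\<And>y. linear (\<lambda>x. f x y)" "\<And>x. linear (f x)"
    and "\<And>y. linear (\<lambda>x. g x y)" "\<And>x. linear (g x)"
    and "\<And>a b. f (basis a) (basis b) = g (basis a) (basis b)"
  shows "f x y = g x y"
proof -
  have "f (basis a) y = g (basis a) y" for a
    by (rule linear_eq_on_basis[OF assms(2) assms(4)]) (rule assms(5))
  then show ?thesis
    by (rule linear_eq_on_basis[OF assms(1) assms(3)])
qed

text \<open>
  Linearity in one argument of a composite expression is decomposed syntactically, one operation
  at a time, by the rules collected below.
\<close>

named_theorems lin_intro

lemma lin_intro_basic [lin_intro]:
  "linear (\<lambda>x. x)"
  "linear f \<Longrightarrow> linear g \<Longrightarrow> linear (\<lambda>x. f x + g x)"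
  by (auto intro: linear_ident linear_compose_add)

lemma lin_intro_lin_ext [lin_intro]: "linear f \<Longrightarrow> linear (\<lambda>x. lin_ext h (f x))"
  using linear_compose[OF _ linear_lin_ext, of f h] by (simp add: o_def)

lemma lin_intro_bilin_ext [lin_intro]:
  "linear f \<Longrightarrow> linear (\<lambda>x. bilin_ext h (f x) y)"
  "linear g \<Longrightarrow> linear (\<lambda>x. bilin_ext h z (g x))"
  using linear_compose[OF _ linear_bilin_ext_left, of f h y]
    linear_compose[OF _ linear_bilin_ext_right, of g h z] by (simp_all add: o_def)

lemma lin_intro_word [lin_intro]:
  "linear f \<Longrightarrow> linear (\<lambda>x. qsh N (f x) y)"
  "linear f \<Longrightarrow> linear (\<lambda>x. qsh N z (f x))"
  "linear g \<Longrightarrow> linear (\<lambda>x. append_letters (g x) l)"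
  "linear h \<Longrightarrow> linear (\<lambda>x. append_letters w (h x))"
  "linear k \<Longrightarrow> linear (\<lambda>x. deconcat (k x))"
  unfolding qsh_def append_letters_def deconcat_def by (intro lin_intro; assumption)+

lemma psi_S_eq_lin_ext: "psi_S N x = lin_ext (\<lambda>f. psi_S N (basis f)) x"
proof (rule linear_eq_on_basis[of "psi_S N"])
  show "linear (psi_S N)"
    unfolding psi_S_def o_def arborification_def symmetrization_def
    by (intro lin_intro)
qed (auto intro: lin_intro)

lemma lin_intro_psi_S [lin_intro]: "linear f \<Longrightarrow> linear (\<lambda>x. psi_S N (f x))"
  by (subst psi_S_eq_lin_ext) (intro lin_intro)

lemma scaleR_mult_poly_mapping:
  "(c *\<^sub>R x) * y = c *\<^sub>R (x * y)" for x y :: "'b::comm_monoid_add \<Rightarrow>\<^sub>0 real"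
proof -
  have "c *\<^sub>R z = Poly_Mapping.single 0 c * z" for z :: "'b \<Rightarrow>\<^sub>0 real"
    unfolding mult_map_scale_conv_mult[symmetric]
    by (rule poly_mapping_eqI) (simp add: Poly_Mapping.map.rep_eq when_def)
  then show ?thesis
    by (simp add: mult.assoc)
qed

lemma lin_intro_mult [lin_intro]:
  fixes f :: "'v::real_vector \<Rightarrow> 'b::comm_monoid_add \<Rightarrow>\<^sub>0 real"
  shows "linear f \<Longrightarrow> linear (\<lambda>x. f x * y)"
    and "linear f \<Longrightarrow> linear (\<lambda>x. y * f x)"
proof -
  assume f: "linear f"
  show "linear (\<lambda>x. f x * y)"
    by (rule linearI)
      (simp_all add: linear_add[OF f] linear_scale[OF f] distrib_right scaleR_mult_poly_mapping)
  then show "linear (\<lambda>x. y * f x)"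
    by (simp add: mult.commute)
qed

lemma keys_scaleR_subset: "Poly_Mapping.keys (c *\<^sub>R x) \<subseteq> Poly_Mapping.keys x"
  by (auto simp: in_keys_iff)

lemma keys_lin_ext:
  "Poly_Mapping.keys (lin_ext f x) \<subseteq> (\<Union>b\<in>Poly_Mapping.keys x. Poly_Mapping.keys (f b))"
proof -
  have "Poly_Mapping.keys (lin_ext f x)
      \<subseteq> (\<Union>b\<in>Poly_Mapping.keys x. Poly_Mapping.keys (Poly_Mapping.lookup x b *\<^sub>R f b))"
    unfolding lin_ext_def by (rule Poly_Mapping.keys_sum)
  also have "\<dots> \<subseteq> (\<Union>b\<in>Poly_Mapping.keys x. Poly_Mapping.keys (f b))"
    by (rule UN_mono[OF order.refl keys_scaleR_subset])
  finally show ?thesis .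
qed

lemma keys_bilin_ext:
  "Poly_Mapping.keys (bilin_ext f x y)
    \<subseteq> (\<Union>a\<in>Poly_Mapping.keys x. \<Union>b\<in>Poly_Mapping.keys y. Poly_Mapping.keys (f a b))"
  unfolding bilin_ext_def by (rule order.trans[OF keys_lin_ext UN_mono[OF order.refl keys_lin_ext]])

lemma mem_free_space_iff: "x \<in> free_space B \<longleftrightarrow> Poly_Mapping.keys x \<subseteq> B"
proof
  have "subspace {x :: 'a \<Rightarrow>\<^sub>0 real. Poly_Mapping.keys x \<subseteq> B}"
    by (auto simp: subspace_def dest!: subsetD[OF Poly_Mapping.keys_add] subsetD[OF keys_scaleR_subset])
  then show "x \<in> free_space B \<Longrightarrow> Poly_Mapping.keys x \<subseteq> B"
    unfolding free_space_def using span_minimal[of "basis ` B" "{x. Poly_Mapping.keys x \<subseteq> B}"]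
    by (force simp: image_subset_iff)
next
  assume "Poly_Mapping.keys x \<subseteq> B"
  then have "(\<Sum>b\<in>Poly_Mapping.keys x. Poly_Mapping.lookup x b *\<^sub>R basis b) \<in> free_space B"
    unfolding free_space_def by (intro span_sum span_scale span_base) auto
  then show "x \<in> free_space B"
    by (simp flip: poly_mapping_decompose)
qed

text \<open>
  Only the values of a rough path on a truncated space are constrained.  Replacing it by this
  globally linear functional makes identities between linear maps applicable to it.
\<close>

lemma linear_functional_on_eq_lin_ext:
  assumes "linear_functional_on (free_space B) \<phi>" "x \<in> free_space B"
  shows "\<phi> x = lin_ext (\<lambda>b. \<phi> (basis b)) x"
proof -
  let ?V = "free_space B" and ?\<phi>' = "lin_ext (\<lambda>b. \<phi> (basis b))"
  have V: "subspace ?V" by (simp add: free_space_def)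
  have add: "\<phi> (x + y) = \<phi> x + \<phi> y" and scale: "\<phi> (c *\<^sub>R x) = c * \<phi> x"
    if "x \<in> ?V" "y \<in> ?V" for x y c
    using assms(1) that by (auto simp: linear_functional_on_def)
  have "\<phi> 0 = 0"
    using scale[OF subspace_0[OF V] subspace_0[OF V], of 0] by simp
  from assms(2)[unfolded free_space_def] have "x \<in> ?V \<and> \<phi> x = ?\<phi>' x"
  proof (induction rule: span_induct_alt)
    case base
    then show ?case
      using \<open>\<phi> 0 = 0\<close> subspace_0[OF V] by (simp add: linear_0[OF linear_lin_ext])
  next
    case (step c b y)
    have "b \<in> ?V"
      using step(1) by (auto simp: free_space_def intro: span_base)
    with step show ?case
      by (auto simp: add scale subspace_add[OF V] subspace_scale[OF V]
          linear_add[OF linear_lin_ext] linear_scale[OF linear_lin_ext])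
  qed
  then show ?thesis by blast
qed

section \<open>Homogeneity of the contracting arborification\<close>

definition homogeneous_words :: "nat \<Rightarrow> nat \<Rightarrow> (nat ^ 'd) list set" where
  "homogeneous_words N n = {w \<in> lists (letters N). word_weight w = n}"

lemma homogeneous_words_append:
  "v \<in> homogeneous_words N m \<Longrightarrow> a \<in> letters N \<Longrightarrow> k = m + msize a \<Longrightarrow>
     v @ [a] \<in> homogeneous_words N k"
  by (simp add: homogeneous_words_def word_weight_def)

lemma homogeneous_words_snocD:
  "v @ [a] \<in> homogeneous_words N k \<Longrightarrow>
     a \<in> letters N \<and> msize a \<le> k \<and> v \<in> homogeneous_words N (k - msize a)"
  by (auto simp: homogeneous_words_def word_weight_def)

lemma keys_append_letters:
  assumes "Poly_Mapping.keys x \<subseteq> homogeneous_words N m"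
    and "\<And>a. a \<in> Poly_Mapping.keys l \<Longrightarrow> a \<in> letters N \<and> k = m + msize a"
  shows "Poly_Mapping.keys (append_letters x l) \<subseteq> homogeneous_words N k"
  using keys_bilin_ext[of "\<lambda>w a. basis (w @ [a])" x l] assms homogeneous_words_append
  unfolding append_letters_def by fastforce

lemma keys_bracket:
  "c \<in> Poly_Mapping.keys (bracket N a b) \<Longrightarrow> c \<in> letters N \<and> msize c = msize a + msize b"
  by (auto simp: bracket_def msize_add split: if_splits)

text \<open>
  Every term of the quasi-shuffle recursion takes letters off its arguments and puts a letter of
  their joint weight back at the end.
\<close>

lemma keys_qsh_word:
  assumes "v \<in> homogeneous_words N m" "w \<in> homogeneous_words N n"
  shows "Poly_Mapping.keys (qsh_word N v w) \<subseteq> homogeneous_words N (m + n)"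
  using assms
proof (induction "length v + length w" arbitrary: v w m n rule: less_induct)
  case less
  show ?case
  proof (cases v rule: rev_cases; cases w rule: rev_cases)
    fix v' a w' b
    assume eq: "v = v' @ [a]" "w = w' @ [b]"
    have a: "a \<in> letters N" "msize a \<le> m" and v': "v' \<in> homogeneous_words N (m - msize a)"
      and b: "b \<in> letters N" "msize b \<le> n" and w': "w' \<in> homogeneous_words N (n - msize b)"
      using homogeneous_words_snocD less.prems unfolding eq by blast+
    have "Poly_Mapping.keys (append_letters (qsh_word N v' w) (basis a))
        \<subseteq> homogeneous_words N (m + n)"
      using a by (intro keys_append_letters[OF less.hyps[OF _ v' less.prems(2)]]) (auto simp: eq)
    moreover have "Poly_Mapping.keys (append_letters (qsh_word N v w') (basis b))
        \<subseteq> homogeneous_words N (m + n)"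
      using b by (intro keys_append_letters[OF less.hyps[OF _ less.prems(1) w']]) (auto simp: eq)
    moreover have "Poly_Mapping.keys (append_letters (qsh_word N v' w') (bracket N a b))
        \<subseteq> homogeneous_words N (m + n)"
      using a b keys_bracket[of _ N a b]
      by (intro keys_append_letters[OF less.hyps[OF _ v' w']]) (auto simp: eq)
    ultimately show ?thesis
      unfolding eq qsh_word_simps
      by (intro order.trans[OF Poly_Mapping.keys_add] Un_least)
  qed (use less.prems in \<open>auto simp: qsh_word_simps homogeneous_words_def word_weight_def\<close>)
qed

lemma keys_qsh:
  assumes "Poly_Mapping.keys x \<subseteq> homogeneous_words N m"
    and "Poly_Mapping.keys y \<subseteq> homogeneous_words N n"
  shows "Poly_Mapping.keys (qsh N x y) \<subseteq> homogeneous_words N (m + n)"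
  using keys_bilin_ext[of "qsh_word N" x y] keys_qsh_word[of _ N m _ n] assms
  unfolding qsh_def by fast

lemma symmetrization_basis:
  "symmetrization (basis f) = basis (image_mset (map_rtree symm_label) f)"
  by (simp add: symmetrization_def)

lemma psi_S_one: "psi_S N 1 = basis []"
  unfolding psi_S_def o_def single_one[symmetric] symmetrization_basis
  by (simp add: arborification_one)

lemma psi_S_graft:
  "psi_S N (basis {#Node a f#}) = append_letters (psi_S N (basis f)) (basis (symm_label a))"
  by (simp add: psi_S_def symmetrization_basis arborification_graft)

lemma psi_S_union:
  "psi_S N (basis (f + g)) = qsh N (psi_S N (basis f)) (psi_S N (basis g))"
  by (simp add: psi_S_def symmetrization_basis arborification_union)

lemma psi_S_mult: "psi_S N (x * y) = qsh N (psi_S N x) (psi_S N y)"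
  by (rule bilinear_eq_on_basis[of "\<lambda>x y. psi_S N (x * y)"])
    (intro lin_intro | simp add: basis_mult psi_S_union)+

lemma msize_symm_label: "msize (symm_label l) = length l"
  using sum_count_set[of l UNIV] by (simp add: msize_def symm_label_def)

lemma symm_label_in_letters:
  assumes "l \<in> tuples N"
  shows "symm_label l \<in> letters N"
proof -
  have "symm_label l \<noteq> 0"
    using assms msize_symm_label[of l] by (auto simp: tuples_def msize_def)
  then show ?thesis
    using assms by (simp add: letters_def tuples_def msize_symm_label)
qed

lemma forest_weight_simps [simp]:
  "forest_weight {#} = 0"
  "forest_weight {#Node a f#} = length a + forest_weight f"
  "forest_weight (f + g) = forest_weight f + forest_weight g"
  by (simp_all add: forest_weight_def)

lemma forests_simps [simp]:
  "{#} \<in> forests A"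
  "{#Node a f#} \<in> forests A \<longleftrightarrow> a \<in> A \<and> f \<in> forests A"
  "f + g \<in> forests A \<longleftrightarrow> f \<in> forests A \<and> g \<in> forests A"
  by (auto simp: forests_def)

text \<open>
  \<open>\<psi>\<^sub>\<S>\<close> and the coproduct are determined by their behaviour under grafting and disjoint union;
  inducting along these two operations avoids a separate treatment of trees.
\<close>

lemma forest_induct [case_names empty graft union]:
  assumes empty: "P {#}"
    and graft: "\<And>a f. P f \<Longrightarrow> P {#Node a f#}"
    and union: "\<And>f g. P f \<Longrightarrow> P g \<Longrightarrow> P (f + g)"
  shows "P f"
proof -
  have forest: "P f" if "\<And>t. t \<in># f \<Longrightarrow> P {#t#}" for f
    using that
  proof (induction f)
    case (add t f)
    then show ?case using union[of "{#t#}" f] by simp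
  qed (rule empty)
  have "P {#t#}" for t
  proof (induction t)
    case (Node a f)
    show ?case by (rule graft[OF forest]) (rule Node)
  qed
  then show ?thesis by (rule forest)
qed

lemma keys_psi_S:
  assumes "f \<in> forests (tuples N)"
  shows "Poly_Mapping.keys (psi_S N (basis f)) \<subseteq> homogeneous_words N (forest_weight f)"
  using assms
proof (induction f rule: forest_induct)
  case empty
  then show ?case
    by (simp add: psi_S_one homogeneous_words_def word_weight_def)
next
  case (graft a f)
  then show ?case
    unfolding psi_S_graft
    by (intro keys_append_letters[where m = "forest_weight f"])
      (auto simp: symm_label_in_letters msize_symm_label)
next
  case (union f g)
  then show ?case
    unfolding psi_S_union forest_weight_simps by (intro keys_qsh) simp_all
qed

section \<open>Compatibility of the coproducts\<close>

definition tensor :: "('a \<Rightarrow>\<^sub>0 real) \<Rightarrow> ('b \<Rightarrow>\<^sub>0 real) \<Rightarrow> ('a \<times> 'b \<Rightarrow>\<^sub>0 real)" where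
  "tensor = bilin_ext (\<lambda>u v. basis (u, v))"

text \<open>The product of the tensor square of the quasi-shuffle algebra.\<close>

definition qsh_tensor ::
  "nat \<Rightarrow> ((nat ^ 'd) list \<times> (nat ^ 'd) list \<Rightarrow>\<^sub>0 real) \<Rightarrow>
   ((nat ^ 'd) list \<times> (nat ^ 'd) list \<Rightarrow>\<^sub>0 real) \<Rightarrow> ((nat ^ 'd) list \<times> (nat ^ 'd) list \<Rightarrow>\<^sub>0 real)"
  where
  "qsh_tensor N = bilin_ext (\<lambda>(u, u') (v, v'). tensor (qsh_word N u v) (qsh_word N u' v'))"

definition append_second ::
  "('a list \<times> 'a list \<Rightarrow>\<^sub>0 real) \<Rightarrow> ('a \<Rightarrow>\<^sub>0 real) \<Rightarrow> ('a list \<times> 'a list \<Rightarrow>\<^sub>0 real)" where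
  "append_second = bilin_ext (\<lambda>(u, v) a. basis (u, v @ [a]))"

lemma lin_intro_tensor [lin_intro]:
  "linear f \<Longrightarrow> linear (\<lambda>x. tensor (f x) y)"
  "linear g \<Longrightarrow> linear (\<lambda>x. tensor z (g x))"
  "linear h \<Longrightarrow> linear (\<lambda>x. qsh_tensor N (h x) p)"
  "linear h \<Longrightarrow> linear (\<lambda>x. qsh_tensor N p (h x))"
  "linear h' \<Longrightarrow> linear (\<lambda>x. append_second (h' x) l)"
  "linear k \<Longrightarrow> linear (\<lambda>x. append_second p' (k x))"
  unfolding tensor_def qsh_tensor_def append_second_def by (intro lin_intro; assumption)+

lemma tensor_basis: "tensor (basis u) (basis v) = basis (u, v)"
  by (simp add: tensor_def)

lemma tensor_eq_on_basis:
  assumes "linear f" "linear g"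
    and "\<And>u v. f (tensor (basis u) (basis v)) = g (tensor (basis u) (basis v))"
  shows "f z = g z"
proof (rule linear_eq_on_basis[of f g, OF assms(1,2)])
  show "f (basis p) = g (basis p)" for p
    using assms(3)[of "fst p" "snd p"] by (simp add: tensor_basis)
qed

lemma qsh_tensor_tensor:
  "qsh_tensor N (tensor x x') (tensor y y') = tensor (qsh N x y) (qsh N x' y')"
proof -
  have *: "qsh_tensor N (tensor (basis u) (basis u')) (tensor y y')
      = tensor (qsh N (basis u) y) (qsh N (basis u') y')" for u u'
    by (rule bilinear_eq_on_basis[of "\<lambda>y y'. qsh_tensor N (tensor (basis u) (basis u')) (tensor y y')"])
      (intro lin_intro | simp add: tensor_basis, simp add: qsh_tensor_def qsh_def)+
  show ?thesis
    by (rule bilinear_eq_on_basis[of "\<lambda>x x'. qsh_tensor N (tensor x x') (tensor y y')"])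
      (intro lin_intro | simp add: *)+
qed

lemma append_second_tensor: "append_second (tensor x y) l = tensor x (append_letters y l)"
proof -
  have *: "append_second (tensor x (basis v)) (basis a) = tensor x (basis (v @ [a]))" for v a
    by (rule linear_eq_on_basis[of "\<lambda>x. append_second (tensor x (basis v)) (basis a)"])
      (intro lin_intro | simp add: tensor_basis, simp add: append_second_def)+
  show ?thesis
    by (rule bilinear_eq_on_basis[of "\<lambda>y l. append_second (tensor x y) l"])
      (intro lin_intro | simp add: *)+
qed

lemma qsh_tensor_append_second_left:
  "qsh_tensor N (append_second z l) (tensor x (basis [])) =
     append_second (qsh_tensor N z (tensor x (basis []))) l"
  by (rule tensor_eq_on_basis[of "\<lambda>z. qsh_tensor N (append_second z l) (tensor x (basis []))"])
    (intro lin_intro | simp add: append_second_tensor qsh_tensor_tensor)+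

lemma qsh_tensor_append_second_right:
  "qsh_tensor N (tensor x (basis [])) (append_second z l) =
     append_second (qsh_tensor N (tensor x (basis [])) z) l"
  by (rule tensor_eq_on_basis[of "\<lambda>z. qsh_tensor N (tensor x (basis [])) (append_second z l)"])
    (intro lin_intro | simp add: append_second_tensor qsh_tensor_tensor)+

text \<open>
  Letters are appended to the second factor only, so on pure tensors this is the recursion of the
  quasi-shuffle product in that factor.
\<close>

lemma qsh_tensor_append_second:
  "qsh_tensor N (append_second p (basis a)) (append_second q (basis b)) =
     append_second (qsh_tensor N p (append_second q (basis b))) (basis a)
     + append_second (qsh_tensor N (append_second p (basis a)) q) (basis b)
     + append_second (qsh_tensor N p q) (bracket N a b)" (is "?L p q = ?R p q")
proof -
  have add: "tensor x (y + y') = tensor x y + tensor x y'"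
    for x y y' :: "(nat ^ 'a) list \<Rightarrow>\<^sub>0 real"
    by (rule linear_add) (intro lin_intro)
  have *: "?L (tensor (basis u) (basis u')) q = ?R (tensor (basis u) (basis u')) q" for u u'
    by (rule tensor_eq_on_basis[of "?L (tensor (basis u) (basis u'))"])
      (intro lin_intro | simp add: append_second_tensor qsh_tensor_tensor qsh_append add
        del: append_letters_basis)+
  show ?thesis
    by (rule tensor_eq_on_basis[of "\<lambda>p. ?L p q"]) (intro lin_intro | rule *)+
qed

lemma deconcat_basis: "deconcat (basis w) = (\<Sum>i\<le>length w. basis (take i w, drop i w))"
  by (simp add: deconcat_def)

lemma deconcat_append_letters:
  "deconcat (append_letters x l) =
     tensor (append_letters x l) (basis []) + append_second (deconcat x) l"
proof (rule bilinear_eq_on_basis[of "\<lambda>x l. deconcat (append_letters x l)"])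
  fix w a
  have "append_second (basis (u, v)) (basis a) = basis (u, v @ [a])" for u v
    by (simp add: append_second_def)
  moreover have "linear (\<lambda>z. append_second z (basis a))"
    by (intro lin_intro)
  ultimately show "deconcat (append_letters (basis w) (basis a)) =
     tensor (append_letters (basis w) (basis a)) (basis []) + append_second (deconcat (basis w)) (basis a)"
    by (simp add: deconcat_basis tensor_basis linear_sum[of "\<lambda>z. append_second z (basis a)"]
        add.commute)
qed (intro lin_intro)+

text \<open>
  Deconcatenation is multiplicative.  In a product of \<open>va\<close> and \<open>wb\<close> either the cut is made
  at the very end, or the last letter (a, b or \<open>[a, b]\<close>) lies to the right of the cut and can be
  removed there; the three recursive terms of the quasi-shuffle product match the three kinds of
  last letter.
\<close>

lemma deconcat_qsh_word:
  "deconcat (qsh_word N v w) = qsh_tensor N (deconcat (basis v)) (deconcat (basis w))"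
proof (induction "length v + length w" arbitrary: v w rule: less_induct)
  case less
  have unit: "qsh_tensor N (tensor (basis []) (basis [])) z = z"
    "qsh_tensor N z (tensor (basis []) (basis [])) = z" for z
  proof -
    show "qsh_tensor N (tensor (basis []) (basis [])) z = z"
      by (rule tensor_eq_on_basis[of "\<lambda>z. qsh_tensor N (tensor (basis []) (basis [])) z" "\<lambda>z. z"])
        (intro lin_intro | simp add: qsh_tensor_tensor)+
    show "qsh_tensor N z (tensor (basis []) (basis [])) = z"
      by (rule tensor_eq_on_basis[of "\<lambda>z. qsh_tensor N z (tensor (basis []) (basis []))" "\<lambda>z. z"])
        (intro lin_intro | simp add: qsh_tensor_tensor)+
  qed
  have Nil: "deconcat (basis ([] :: (nat ^ 'a) list)) = tensor (basis []) (basis [])"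
    by (simp add: deconcat_basis tensor_basis)
  show ?case
  proof (cases v rule: rev_cases; cases w rule: rev_cases)
    fix v' a w' b
    assume eq: "v = v' @ [a]" "w = w' @ [b]"
    have IH: "deconcat (qsh_word N v' w) = qsh_tensor N (deconcat (basis v')) (deconcat (basis w))"
      "deconcat (qsh_word N v w') = qsh_tensor N (deconcat (basis v)) (deconcat (basis w'))"
      "deconcat (qsh_word N v' w') = qsh_tensor N (deconcat (basis v')) (deconcat (basis w'))"
      using less[of v' w] less[of v w'] less[of v' w'] by (simp_all add: eq)
    have lin: "linear (deconcat :: ((nat ^ 'a) list \<Rightarrow>\<^sub>0 real) \<Rightarrow> _)"
      "linear (\<lambda>x :: (nat ^ 'a) list \<Rightarrow>\<^sub>0 real. tensor x (basis ([] :: (nat ^ 'a) list)))"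
      "linear (\<lambda>z. append_second z l)"
      "linear (qsh_tensor N z)" "linear (\<lambda>z. qsh_tensor N z z')"
      for l :: "nat ^ 'a \<Rightarrow>\<^sub>0 real" and z z' :: "(nat ^ 'a) list \<times> (nat ^ 'a) list \<Rightarrow>\<^sub>0 real"
      by (intro lin_intro)+
    let ?\<delta>v = "deconcat (basis v')" and ?\<delta>w = "deconcat (basis w')"
    have v: "deconcat (basis v) = tensor (basis v) (basis []) + append_second ?\<delta>v (basis a)"
      and w: "deconcat (basis w) = tensor (basis w) (basis []) + append_second ?\<delta>w (basis b)"
      using deconcat_append_letters[of "basis v'" "basis a"]
        deconcat_append_letters[of "basis w'" "basis b"] by (simp_all add: eq)
    have split: "qsh_word N v w = append_letters (qsh_word N v' w) (basis a)
        + append_letters (qsh_word N v w') (basis b)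
        + append_letters (qsh_word N v' w') (bracket N a b)"
      by (simp add: eq qsh_word_simps)
    have "deconcat (qsh_word N v w) = tensor (qsh_word N v w) (basis [])
        + append_second (qsh_tensor N ?\<delta>v (deconcat (basis w))) (basis a)
        + append_second (qsh_tensor N (deconcat (basis v)) ?\<delta>w) (basis b)
        + append_second (qsh_tensor N ?\<delta>v ?\<delta>w) (bracket N a b)"
      unfolding split
      by (simp add: linear_add[OF lin(1)] linear_add[OF lin(2)] deconcat_append_letters IH add_ac)
    moreover have "qsh_word N v w = qsh N (basis v) (basis w)"
      by (simp add: qsh_def)
    ultimately show ?thesis
      unfolding v w
      by (simp add: linear_add[OF lin(3)] linear_add[OF lin(4)] linear_add[OF lin(5)]
          qsh_tensor_append_second qsh_tensor_append_second_left qsh_tensor_append_second_right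
          qsh_tensor_tensor add_ac)
  qed (simp_all add: qsh_word_simps Nil unit)
qed

lemma deconcat_qsh: "deconcat (qsh N x y) = qsh_tensor N (deconcat x) (deconcat y)"
proof (rule bilinear_eq_on_basis[of "\<lambda>x y. deconcat (qsh N x y)"])
  show "deconcat (qsh N (basis v) (basis w)) = qsh_tensor N (deconcat (basis v)) (deconcat (basis w))"
    for v w
    by (simp add: qsh_def deconcat_qsh_word)
qed (intro lin_intro)+

definition psi_S_tensor ::
  "nat \<Rightarrow> ('d list forest \<times> 'd list forest \<Rightarrow>\<^sub>0 real) \<Rightarrow>
   ((nat ^ 'd) list \<times> (nat ^ 'd) list \<Rightarrow>\<^sub>0 real)" where
  "psi_S_tensor N = lin_ext (\<lambda>(u, v). tensor (psi_S N (basis u)) (psi_S N (basis v)))"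

lemma psi_S_tensor_basis:
  "psi_S_tensor N (basis (u, v)) = tensor (psi_S N (basis u)) (psi_S N (basis v))"
  by (simp add: psi_S_tensor_def)

lemma lin_intro_psi_S_tensor [lin_intro]: "linear f \<Longrightarrow> linear (\<lambda>x. psi_S_tensor N (f x))"
  unfolding psi_S_tensor_def by (intro lin_intro)

lemma psi_S_tensor_mult:
  "psi_S_tensor N (x * y) = qsh_tensor N (psi_S_tensor N x) (psi_S_tensor N y)"
proof (rule bilinear_eq_on_basis[of "\<lambda>x y. psi_S_tensor N (x * y)"])
  fix p q
  show "psi_S_tensor N (basis p * basis q) =
    qsh_tensor N (psi_S_tensor N (basis p)) (psi_S_tensor N (basis q))"
    by (cases p; cases q)
      (simp add: basis_mult psi_S_tensor_basis psi_S_union qsh_tensor_tensor)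
qed (intro lin_intro)+

lemma psi_S_tensor_graft:
  "psi_S_tensor N (lin_ext (\<lambda>(g, h). basis (g, {#Node a h#})) z) =
     append_second (psi_S_tensor N z) (basis (symm_label a))"
  by (rule tensor_eq_on_basis[of "\<lambda>z. psi_S_tensor N (lin_ext (\<lambda>(g, h). basis (g, {#Node a h#})) z)"])
    (intro lin_intro | simp add: tensor_basis psi_S_tensor_basis psi_S_graft append_second_tensor)+

lemma coproduct_empty: "coproduct (basis {#}) = basis ({#}, {#})"
  unfolding coproduct_def lin_ext_basis
  by (simp only: image_mset_empty prod_mset_empty single_one[symmetric] zero_prod_def)

text \<open>
  Both sides are algebra morphisms, hence it suffices to compare them on a tree
  \<open>B\<^sup>+\<^sub>a(f)\<close>.  There the recursion of the forest coproduct for grafting is mapped to that of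
  deconcatenation for appending a letter.
\<close>

lemma deconcat_psi_S:
  fixes x :: "'d::finite list forest \<Rightarrow>\<^sub>0 real"
  shows "deconcat (psi_S N x) = psi_S_tensor N (coproduct x)"
proof (rule linear_eq_on_basis[of "\<lambda>x. deconcat (psi_S N x)"])
  show "deconcat (psi_S N (basis f)) = psi_S_tensor N (coproduct (basis f))"
    for f :: "'d list forest"
  proof (induction f rule: forest_induct)
    case empty
    show ?case
      unfolding coproduct_empty psi_S_tensor_basis
      by (simp add: psi_S_one deconcat_basis tensor_basis)
  next
    case (graft a f)
    have "linear (psi_S_tensor N :: ('d list forest \<times> 'd list forest \<Rightarrow>\<^sub>0 real) \<Rightarrow> _)"
      by (intro lin_intro)
    from linear_add[OF this] graft show ?case
      by (simp add: coproduct_graft psi_S_tensor_graft psi_S_tensor_basis psi_S_one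
          psi_S_graft deconcat_append_letters)
  next
    case (union f g)
    then show ?case
      by (simp add: psi_S_union coproduct_union deconcat_qsh psi_S_tensor_mult)
  qed
qed (intro lin_intro | simp add: coproduct_def)+

text \<open>
  Dual form of the previous lemma: the functional \<open>\<phi> \<otimes> \<theta>\<close> is applied to both sides.  This
  requires \<open>\<phi>\<close> and \<open>\<theta>\<close> to be linear on the whole space, since \<open>\<psi>\<^sub>\<S>\<close> of a forest is a
  combination of several words.
\<close>

lemma convolution_psi_S:
  assumes "linear \<phi>" "linear \<theta>"
  shows "convolution deconcat \<phi> \<theta> (psi_S N h) =
    convolution coproduct (\<lambda>f. \<phi> (psi_S N f)) (\<lambda>f. \<theta> (psi_S N f)) h"
proof -
  let ?\<mu> = "lin_ext (\<lambda>(u, v). \<phi> (basis u) * \<theta> (basis v))"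
  have \<mu>: "?\<mu> (tensor x y) = \<phi> x * \<theta> y" for x y
  proof (rule bilinear_eq_on_basis[of "\<lambda>x y. ?\<mu> (tensor x y)"])
    show "linear (\<lambda>x. \<phi> x * \<theta> y)" for y
      by (rule linearI) (simp_all add: linear_add[OF assms(1)] linear_scale[OF assms(1)] distrib_right)
    show "linear (\<lambda>y. \<phi> x * \<theta> y)" for x
      by (rule linearI) (simp_all add: linear_add[OF assms(2)] linear_scale[OF assms(2)] distrib_left)
  qed (intro lin_intro | simp add: tensor_basis)+
  have "?\<mu> (psi_S_tensor N z) = lin_ext (\<lambda>(u, v). \<phi> (psi_S N (basis u)) * \<theta> (psi_S N (basis v))) z"
    for z
    by (rule tensor_eq_on_basis[of "\<lambda>z. ?\<mu> (psi_S_tensor N z)"])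
      (intro lin_intro | simp add: \<mu> tensor_basis psi_S_tensor_basis)+
  then show ?thesis
    by (simp add: convolution_def deconcat_psi_S)
qed

text \<open>
  A cut of a forest distributes its nodes over the two factors.  In particular the factors of the
  coproduct stay inside the truncated space.
\<close>

lemma keys_coproduct:
  assumes "f \<in> forests A"
  shows "Poly_Mapping.keys (coproduct (basis f)) \<subseteq>
    {(u, v). u \<in> forests A \<and> v \<in> forests A \<and> forest_weight u + forest_weight v = forest_weight f}"
  using assms
proof (induction f rule: forest_induct)
  case empty
  show ?case
    unfolding coproduct_empty by simp
next
  case (graft a f)
  have "Poly_Mapping.keys (lin_ext (\<lambda>(g, h). basis (g, {#Node a h#})) (coproduct (basis f)))
      \<subseteq> (\<Union>(g, h)\<in>Poly_Mapping.keys (coproduct (basis f)). {(g, {#Node a h#})})"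
    by (rule order.trans[OF keys_lin_ext]) (auto split: prod.splits if_splits)
  then show ?case
    using graft unfolding coproduct_graft by (intro order.trans[OF Poly_Mapping.keys_add]) fastforce
next
  case (union f g)
  then show ?case
    unfolding coproduct_union by (intro order.trans[OF Poly_Mapping.keys_mult]) fastforce
qed

section \<open>Bracket polynomials\<close>

text \<open>
  A splitting of \<open>i # l\<close> arises from a splitting of l by putting i into one of its two parts.  This
  allows sums over splittings to be treated by induction on the list.
\<close>

lemma sum_splittings_Cons:
  fixes F :: "'a list \<Rightarrow> 'a list \<Rightarrow> 'v::comm_monoid_add"
  shows "(\<Sum>K\<in>Pow {..<length (i # l)}. F (nths (i # l) K) (nths (i # l) ({..<length (i # l)} - K))) =
    (\<Sum>K\<in>Pow {..<length l}. F (i # nths l K) (nths l ({..<length l} - K))) +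
    (\<Sum>K\<in>Pow {..<length l}. F (nths l K) (i # nths l ({..<length l} - K)))"
proof -
  let ?P = "Pow (Suc ` {..<length l})"
  have shift: "sum G ?P = (\<Sum>K\<in>Pow {..<length l}. G (Suc ` K))" for G :: "nat set \<Rightarrow> 'v"
    by (subst image_Pow_surj[OF refl, symmetric], subst sum.reindex)
      (auto simp: inj_on_def)
  have "(\<Sum>K\<in>Pow {..<length (i # l)}. G K) = sum G ?P + sum G (insert 0 ` ?P)" for G :: "nat set \<Rightarrow> 'v"
    unfolding list.size add_0_right add_Suc_right lessThan_Suc_eq_insert_0 Pow_insert
    by (rule sum.union_disjoint) auto
  moreover have "sum G (insert 0 ` ?P) = (\<Sum>K\<in>?P. G (insert 0 K))" for G :: "nat set \<Rightarrow> 'v"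
    by (subst sum.reindex) (auto simp: inj_on_def)
  ultimately have "(\<Sum>K\<in>Pow {..<length (i # l)}. G K) =
      (\<Sum>K\<in>Pow {..<length l}. G (insert 0 (Suc ` K))) + (\<Sum>K\<in>Pow {..<length l}. G (Suc ` K))"
    for G :: "nat set \<Rightarrow> 'v"
    by (simp add: shift add.commute)
  moreover have "{j. Suc j < Suc (length l) \<and> Suc j \<notin> Suc ` K} = {..<length l} - K" for K
    by auto
  moreover have "{j. Suc j \<in> Suc ` K} = K" for K
    by auto
  ultimately show ?thesis
    by (simp add: nths_Cons)
qed

abbreviation qsh_units :: "nat \<Rightarrow> 'd list \<Rightarrow> ((nat ^ 'd) list \<Rightarrow>\<^sub>0 real)" where
  "qsh_units N l \<equiv> qsh_prod N (image_mset (\<lambda>i. basis [symm_label [i]]) (mset l))"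

lemma symm_label_Cons: "symm_label (i # l) = symm_label [i] + symm_label l"
  by (simp add: symm_label_eq_sum)

lemma bracket_symm_label:
  assumes "b \<noteq> []" "length (i # b) \<le> N"
  shows "bracket N (symm_label [i]) (symm_label b) = basis (symm_label (i # b))"
proof -
  have "[i] \<in> tuples N" "b \<in> tuples N" "i # b \<in> tuples N"
    using assms by (auto simp: tuples_def Suc_le_eq)
  then have "symm_label [i] \<in> letters N" "symm_label b \<in> letters N" "symm_label (i # b) \<in> letters N"
    by (auto intro: symm_label_in_letters)
  then show ?thesis
    by (simp add: bracket_def symm_label_Cons[of i b])
qed

lemma nths_proper:
  assumes "K \<subseteq> {..<length l}" "K \<noteq> {}"
  shows "nths l K \<noteq> []" "length (nths l K) \<le> length l"
proof -
  from assms have "set (nths l K) \<noteq> {}"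
    unfolding set_nths by auto
  then show "nths l K \<noteq> []" by auto
  show "length (nths l K) \<le> length l"
    using card_mono[of "{..<length l}" "{i. i < length l \<and> i \<in> K}"] by (auto simp: length_nths)
qed

text \<open>
  The words of a product of single letters, sorted by their last letter: it is the sum of a
  non-empty family of the factors, and the rest of the word comes from the product of the
  other factors.  Since \<open>length l \<le> N\<close>, no contraction is truncated to 0.  When a further
  factor \<open>i\<close> is multiplied in, it becomes the last letter itself, or is absorbed by
  the previous last letter, or joins the product in front of it.
\<close>

lemma qsh_prod_units:
  fixes l :: "'d::finite list"
  assumes "l \<noteq> []" "length l \<le> N"
  shows "qsh_units N l = (\<Sum>K\<in>Pow {..<length l} - {{}}.
    append_letters (qsh_units N (nths l ({..<length l} - K))) (basis (symm_label (nths l K))))"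
  using assms
proof (induction l rule: list_nonempty_induct)
  case (single i)
  have "Pow {..<length [i]} - {{}} = {{0}}"
    by (auto simp: lessThan_Suc)
  then show ?case
    using append_letters_basis[of "[]" "symm_label [i]"] by (simp add: qsh_prod_simps)
next
  case (cons i l)
  let ?F = "\<lambda>b a. append_letters (qsh_units N a) (basis (symm_label b))"
  let ?P = "Pow {..<length l} - {{}}"
  let ?c = "\<lambda>K. {..<length l} - K"
  have split: "sum G (Pow {..<n}) = G {} + sum G (Pow {..<n} - {{}})"
    for n and G :: "nat set \<Rightarrow> (nat ^ 'd) list \<Rightarrow>\<^sub>0 real"
    by (rule sum.remove) auto
  have step: "qsh N (basis [symm_label [i]]) (?F (nths l K) (nths l (?c K))) =
      append_letters (?F (nths l K) (nths l (?c K))) (basis (symm_label [i]))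
      + ?F (nths l K) (i # nths l (?c K)) + ?F (i # nths l K) (nths l (?c K))"
    if "K \<in> ?P" for K
  proof -
    have "bracket N (symm_label [i]) (symm_label (nths l K)) = basis (symm_label (i # nths l K))"
      using that nths_proper[of K l] cons.prems by (intro bracket_symm_label) auto
    then show ?thesis
      using qsh_append[of N "basis []" "symm_label [i]" "qsh_units N (nths l (?c K))" "symm_label (nths l K)"]
      by (simp add: qsh_prod_simps)
  qed
  have "qsh_units N (i # l) = qsh N (basis [symm_label [i]]) (\<Sum>K\<in>?P. ?F (nths l K) (nths l (?c K)))"
    using cons.IH cons.prems by (simp add: qsh_prod_simps)
  also have "\<dots> = (\<Sum>K\<in>?P. qsh N (basis [symm_label [i]]) (?F (nths l K) (nths l (?c K))))"
    by (rule linear_sum[OF linear_qsh_right])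
  also have "\<dots> = append_letters (\<Sum>K\<in>?P. ?F (nths l K) (nths l (?c K))) (basis (symm_label [i]))
      + (\<Sum>K\<in>?P. ?F (nths l K) (i # nths l (?c K))) + (\<Sum>K\<in>?P. ?F (i # nths l K) (nths l (?c K)))"
    by (simp add: step sum.distrib linear_sum[OF linear_append_letters_left] del: Diff_iff cong: sum.cong)
  also have "\<dots> = ?F [i] l
      + (\<Sum>K\<in>?P. ?F (nths l K) (i # nths l (?c K))) + (\<Sum>K\<in>?P. ?F (i # nths l K) (nths l (?c K)))"
    using cons.IH cons.prems by simp
  \<comment> \<open>The term in which i alone is the last letter is the one that the last sum lacks at the empty
    set.  Adding the term of the empty set also to the other sum makes both range over all
    subsets.\<close>
  finally have "?F [] (i # l) + qsh_units N (i # l) =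
      (\<Sum>K\<in>Pow {..<length l}. ?F (i # nths l K) (nths l (?c K)))
      + (\<Sum>K\<in>Pow {..<length l}. ?F (nths l K) (i # nths l (?c K)))"
    unfolding split by (simp add: nths_all add_ac)
  also have "\<dots> = (\<Sum>K\<in>Pow {..<length (i # l)}.
      ?F (nths (i # l) K) (nths (i # l) ({..<length (i # l)} - K)))"
    by (rule sum_splittings_Cons[symmetric])
  finally show ?case
    unfolding split by (simp add: nths_all)
qed

lemma psi_S_bullets: "psi_S N (basis (image_mset (\<lambda>i. bullet [i]) (mset a))) = qsh_units N a"
proof (induction a)
  case Nil
  show ?case by (simp add: psi_S_one qsh_prod_simps)
next
  case (Cons i a)
  have "psi_S N (basis {#bullet [i]#}) = basis [symm_label [i]]"
    by (simp add: psi_S_graft psi_S_one)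
  then show ?case
    using Cons psi_S_union[of N "{#bullet [i]#}"] by (simp add: qsh_prod_simps)
qed

text \<open>
  In the sum of \<open>qsh_prod_units\<close> the full set K contributes the letter \<open>S(l)\<close>, and the proper
  subsets contribute exactly the terms that the bracket polynomial subtracts.
\<close>

lemma psi_S_bracket_polynomial:
  fixes l :: "'d::finite list"
  assumes "l \<in> tuples N"
  shows "psi_S N (bracket_polynomial l) = psi_S N (basis {#bullet l#})"
proof -
  have lin: "linear (psi_S N :: ('d list forest \<Rightarrow>\<^sub>0 real) \<Rightarrow> _)"
    by (intro lin_intro)
  let ?F = "\<lambda>K. append_letters (qsh_units N (nths l ({..<length l} - K))) (basis (symm_label (nths l K)))"
  let ?P = "{K. K \<subseteq> {..<length l} \<and> K \<noteq> {} \<and> K \<noteq> {..<length l}}"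
  have l: "l \<noteq> []" "length l \<le> N"
    using assms by (auto simp: tuples_def)
  have "psi_S N (bracket_polynomial l) = qsh_units N l - sum ?F ?P"
    by (simp add: bracket_polynomial_def linear_diff[OF lin] linear_sum[OF lin] psi_S_graft psi_S_bullets)
  moreover have "qsh_units N l = ?F {..<length l} + sum ?F ?P"
  proof -
    have "qsh_units N l = sum ?F (Pow {..<length l} - {{}})"
      by (rule qsh_prod_units[OF l])
    also have "Pow {..<length l} - {{}} = insert {..<length l} ?P"
      using l by auto
    finally show ?thesis
      by (subst (asm) sum.insert) auto
  qed
  moreover have "?F {..<length l} = psi_S N (basis {#bullet l#})"
    by (simp add: nths_all psi_S_graft psi_S_one qsh_prod_simps)
  ultimately show ?thesis by simp
qed

section \<open>Symmetrical labels\<close>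

lemma symm_label_cong:
  assumes "mset a = mset b"
  shows "symm_label a = symm_label b"
  by (simp add: symm_label_def count_mset[symmetric] assms)

lemma psi_S_symmetric:
  fixes \<sigma> \<tau> :: "'d::finite list forest"
  assumes "symmetric_forests \<sigma> \<tau>"
  shows "psi_S N (basis \<sigma>) = psi_S N (basis \<tau>)"
proof -
  have trees: "map_rtree symm_label t = map_rtree symm_label u"
    if "rel_rtree (\<lambda>a b. mset a = mset b) t u" for t u :: "'d list rtree"
  proof -
    have "rel_rtree (\<lambda>a b. symm_label a = symm_label b) t u"
      using that by (rule rtree.rel_mono_strong) (rule symm_label_cong)
    then show ?thesis
      by (simp add: rtree.rel_map flip: rtree.rel_eq)
  qed
  have "rel_mset (\<lambda>t u. map_rtree symm_label t = map_rtree symm_label u) \<sigma> \<tau>"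
    using assms unfolding symmetric_forests_def by (rule multiset.rel_mono_strong) (rule trees)
  then have "image_mset (map_rtree symm_label) \<sigma> = image_mset (map_rtree symm_label) \<tau>"
    by (simp add: multiset.rel_map flip: multiset.rel_eq)
  then show ?thesis
    by (simp add: psi_S_def symmetrization_basis)
qed

section \<open>Pulling back rough paths\<close>

lemma psi_S_free_space:
  assumes "x \<in> free_space (trunc_basis \<gamma> (forests (tuples N)) forest_weight)"
  shows "psi_S N x \<in> free_space (trunc_basis \<gamma> (lists (letters N)) word_weight)"
proof -
  have "Poly_Mapping.keys (psi_S N (basis f)) \<subseteq> trunc_basis \<gamma> (lists (letters N)) word_weight"
    if "f \<in> Poly_Mapping.keys x" for f
    using that assms keys_psi_S[of f N]
    by (force simp: mem_free_space_iff trunc_basis_def homogeneous_words_def)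
  then show ?thesis
    unfolding mem_free_space_iff psi_S_eq_lin_ext[of N x] by (intro order.trans[OF keys_lin_ext] UN_least)
qed

text \<open>
  A bound for a linear functional passes from the words to a homogeneous combination of words,
  since all of them are compared with the same power of \<open>\<bar>t - s\<bar>\<close>.
\<close>

lemma bdd_above_homogeneous:
  fixes Y :: "real \<Rightarrow> real \<Rightarrow> ('b \<Rightarrow>\<^sub>0 real) \<Rightarrow> real" and R :: "real \<Rightarrow> real \<Rightarrow> bool"
  assumes "\<And>b. b \<in> Poly_Mapping.keys x \<Longrightarrow> bdd_above {\<bar>Y s t (basis b)\<bar> * \<rho> s t | s t. R s t}"
    and Y: "\<And>s t. R s t \<Longrightarrow> Y s t x = lin_ext (\<lambda>b. Y s t (basis b)) x"
    and \<rho>: "\<And>s t. 0 \<le> \<rho> s t"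
  shows "bdd_above {\<bar>Y s t x\<bar> * \<rho> s t | s t. R s t}"
proof -
  have "\<forall>b\<in>Poly_Mapping.keys x. \<exists>M. \<forall>s t. R s t \<longrightarrow> \<bar>Y s t (basis b)\<bar> * \<rho> s t \<le> M"
    using assms(1) unfolding bdd_above_def by blast
  then obtain M where M: "\<And>b s t. b \<in> Poly_Mapping.keys x \<Longrightarrow> R s t \<Longrightarrow> \<bar>Y s t (basis b)\<bar> * \<rho> s t \<le> M b"
    by metis
  have "\<bar>Y s t x\<bar> * \<rho> s t \<le> (\<Sum>b\<in>Poly_Mapping.keys x. \<bar>Poly_Mapping.lookup x b\<bar> * M b)" if "R s t" for s t
  proof -
    have "\<bar>Y s t x\<bar> \<le> (\<Sum>b\<in>Poly_Mapping.keys x. \<bar>Poly_Mapping.lookup x b * Y s t (basis b)\<bar>)"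
      unfolding Y[OF that] lin_ext_def real_scaleR_def by (rule sum_abs)
    then have "\<bar>Y s t x\<bar> * \<rho> s t
        \<le> (\<Sum>b\<in>Poly_Mapping.keys x. \<bar>Poly_Mapping.lookup x b * Y s t (basis b)\<bar>) * \<rho> s t"
      using \<rho> by (rule mult_right_mono)
    also have "\<dots> = (\<Sum>b\<in>Poly_Mapping.keys x. \<bar>Poly_Mapping.lookup x b\<bar> * (\<bar>Y s t (basis b)\<bar> * \<rho> s t))"
      by (simp add: sum_distrib_right abs_mult mult.assoc)
    also have "\<dots> \<le> (\<Sum>b\<in>Poly_Mapping.keys x. \<bar>Poly_Mapping.lookup x b\<bar> * M b)"
      using M that by (intro sum_mono mult_left_mono) auto
    finally show ?thesis .
  qed
  then show ?thesis
    unfolding bdd_above_def by blast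
qed

lemma convolution_cong:
  assumes "\<And>u v. (u, v) \<in> Poly_Mapping.keys (coprod h) \<Longrightarrow>
    \<phi> (basis u) = \<phi>' (basis u) \<and> \<theta> (basis v) = \<theta>' (basis v)"
  shows "convolution coprod \<phi> \<theta> h = convolution coprod \<phi>' \<theta>' h"
  unfolding convolution_def lin_ext_def using assms by (intro sum.cong) auto

theorem theorem4p16:
  fixes \<gamma> T :: real
    and X :: "real \<Rightarrow> real \<Rightarrow> ((nat ^ 'd) list \<Rightarrow>\<^sub>0 real) \<Rightarrow> real"
  assumes "0 < \<gamma>" and "\<gamma> < 1" and "T > 0"
    and "quasi_geometric_bracket_extension \<gamma> T X"
  shows "simple_bracket_extension \<gamma> T (\<lambda>s t f. X s t (psi_S (trunc \<gamma>) f))"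
proof -
  define N where "N = trunc \<gamma>"
  define BW where "BW = trunc_basis \<gamma> (lists (letters N :: (nat ^ 'd) set)) word_weight"
  define BF where "BF = trunc_basis \<gamma> (forests (tuples N :: 'd list set)) forest_weight"
  let ?VW = "free_space BW" and ?VF = "free_space BF" and ?I = "{0..T}"
  have "weighted_rough_path \<gamma> T (lists (letters N)) word_weight (qsh N) deconcat X"
    using assms(4) by (simp add: quasi_geometric_bracket_extension_def N_def)
  note X = this[unfolded weighted_rough_path_def Let_def, folded BW_def]
  have lin: "linear_functional_on ?VW (X s t)" if "s \<in> ?I" "t \<in> ?I" for s t
    using conjunct1[OF X] that by blast
  have mult: "X s t (qsh N x y) = X s t x * X s t y"
    if "s \<in> ?I" "t \<in> ?I" "x \<in> ?VW" "y \<in> ?VW" "qsh N x y \<in> ?VW" for s t x y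
    using conjunct1[OF conjunct2[OF X]] that by blast
  have chen: "convolution deconcat (X s u) (X u t) h = X s t h"
    if "s \<in> ?I" "u \<in> ?I" "t \<in> ?I" "h \<in> ?VW" for s u t h
    using conjunct1[OF conjunct2[OF conjunct2[OF X]]] that by blast
  have bound: "bdd_above {\<bar>X s t (basis w)\<bar> * \<bar>t - s\<bar> powr (- \<gamma> * real (word_weight w)) | s t.
      s \<in> ?I \<and> t \<in> ?I \<and> s \<noteq> t}" if "w \<in> BW" for w
    using conjunct2[OF conjunct2[OF conjunct2[OF X]]] that by (rule bspec)
  have psi: "psi_S N x \<in> ?VW" if "x \<in> ?VF" for x
    using that psi_S_free_space unfolding BW_def BF_def by blast
  have psi_lin: "linear (psi_S N :: ('d list forest \<Rightarrow>\<^sub>0 real) \<Rightarrow> _)"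
    by (intro lin_intro)
  have basis_VF: "basis f \<in> ?VF \<longleftrightarrow> f \<in> BF" for f
    by (simp add: mem_free_space_iff)
  have psi_X_lin: "linear_functional_on ?VF (\<lambda>f. X s t (psi_S N f))" if "s \<in> ?I" "t \<in> ?I" for s t
    using lin[OF that] psi
    by (simp add: linear_functional_on_def linear_add[OF psi_lin] linear_scale[OF psi_lin])
  \<comment> \<open>The product of the images lies in the truncated space because it is the image of the product.\<close>
  have psi_X_mult: "X s t (psi_S N (x * y)) = X s t (psi_S N x) * X s t (psi_S N y)"
    if "s \<in> ?I" "t \<in> ?I" "x \<in> ?VF" "y \<in> ?VF" "x * y \<in> ?VF" for s t x y
    using mult[OF that(1,2) psi[OF that(3)] psi[OF that(4)]] psi[OF that(5)] by (simp add: psi_S_mult)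
  have psi_X_chen: "convolution coproduct (\<lambda>f. X s u (psi_S N f)) (\<lambda>f. X u t (psi_S N f)) h =
      X s t (psi_S N h)"
    if I: "s \<in> ?I" "u \<in> ?I" "t \<in> ?I" and h: "h \<in> ?VF" for s u t h
  proof -
    let ?X = "\<lambda>s t. lin_ext (\<lambda>w. X s t (basis w))"
    \<comment> \<open>Both factors of a term in the coproduct of h have at most the weight of h, so
      there the functionals may be exchanged for their linear extensions.\<close>
    have supp: "g \<in> BF \<and> k \<in> BF" if gk: "(g, k) \<in> Poly_Mapping.keys (coproduct h)" for g k
    proof -
      obtain f where f: "f \<in> Poly_Mapping.keys h" "(g, k) \<in> Poly_Mapping.keys (coproduct (basis f))"
        using gk keys_lin_ext[of "\<lambda>f. prod_mset (image_mset coproduct_tree f)" h]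
        by (fastforce simp: coproduct_def)
      then have "f \<in> BF"
        using h by (auto simp: mem_free_space_iff)
      then show ?thesis
        using f(2) keys_coproduct[of f "tuples N"] by (fastforce simp: BF_def trunc_basis_def)
    qed
    have "X s' t' (psi_S N (basis f)) = ?X s' t' (psi_S N (basis f))"
      if "s' \<in> ?I" "t' \<in> ?I" "f \<in> BF" for s' t' f
      using that psi by (intro linear_functional_on_eq_lin_ext[OF lin]) (auto simp: basis_VF)
    then have "convolution coproduct (\<lambda>f. X s u (psi_S N f)) (\<lambda>f. X u t (psi_S N f)) h =
        convolution coproduct (\<lambda>f. ?X s u (psi_S N f)) (\<lambda>f. ?X u t (psi_S N f)) h"
      using I supp by (intro convolution_cong) blast
    also have "\<dots> = convolution deconcat (?X s u) (?X u t) (psi_S N h)"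
      by (rule convolution_psi_S[symmetric]) (rule linear_lin_ext)+
    also have "\<dots> = convolution deconcat (X s u) (X u t) (psi_S N h)"
      by (rule convolution_cong) simp
    also have "\<dots> = X s t (psi_S N h)"
      using I psi[OF h] by (rule chen)
    finally show ?thesis .
  qed
  have psi_X_bound: "bdd_above {\<bar>X s t (psi_S N (basis f))\<bar> * \<bar>t - s\<bar> powr (- \<gamma> * real (forest_weight f)) | s t.
         s \<in> ?I \<and> t \<in> ?I \<and> s \<noteq> t}" if "f \<in> BF" for f
  proof (rule bdd_above_homogeneous[of _ X])
    fix w assume "w \<in> Poly_Mapping.keys (psi_S N (basis f))"
    then have "w \<in> BW" "word_weight w = forest_weight f"
      using that keys_psi_S[of f N]
      by (auto simp: BW_def BF_def trunc_basis_def homogeneous_words_def)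
    then show "bdd_above {\<bar>X s t (basis w)\<bar> * \<bar>t - s\<bar> powr (- \<gamma> * real (forest_weight f)) | s t.
         s \<in> ?I \<and> t \<in> ?I \<and> s \<noteq> t}"
      using bound[of w] by simp
  next
    fix s t assume "s \<in> ?I \<and> t \<in> ?I \<and> s \<noteq> t"
    then show "X s t (psi_S N (basis f)) = lin_ext (\<lambda>b. X s t (basis b)) (psi_S N (basis f))"
      using that psi by (intro linear_functional_on_eq_lin_ext[OF lin]) (auto simp: basis_VF)
  qed simp
  have "weighted_rough_path \<gamma> T (forests (tuples N)) forest_weight (*) coproduct
      (\<lambda>s t f. X s t (psi_S N f))"
    unfolding weighted_rough_path_def Let_def BF_def[symmetric]
    by (intro conjI ballI impI psi_X_lin psi_X_mult psi_X_chen psi_X_bound)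
  then show ?thesis
    unfolding simple_bracket_extension_def N_def
    by (intro conjI ballI impI)
      (simp_all only: psi_S_bracket_polynomial psi_S_symmetric)
qed

end
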